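(* Let $S$ be a join-semilattice satisfying the minimal join-cover refinement property (MCRP). Then the ideal lattice $\operatorname{Id}S$ of $S$ is bi-algebraic, that is, both algebraic and dually algebraic.
   Context: Let $S$ be a join-semilattice. An ideal of $S$ is a lower subset closed under finite joins; if $S$ has a zero element, ideals contain it, and if $S$ has no zero element, the empty set is counted as an ideal. $\operatorname{Id}S$ is the set of ideals of $S$ ordered by inclusion. A lattice $L$ is algebraic if it is complete and every element is a join of compact elements, where $a$ is compact if for every upward directed $X\subseteq L$ with $a\leq\bigvee X$ there is $x\in X$ with $a\leq x$. $L$ is dually algebraic if its order dual is algebraic. Put $S^-=S\setminus\{0\}$ if $S$ has a zero (least) element, and $S^-=S$ otherwise. For $X\subseteq S$, $\downarrow X=\{y\in S\mid \exists x\in X,\ y\leq x\}$; $X$ refines $Y$, written $X\ll Y$, if $X\subseteq\downarrow Y$. For $a\in S^-$: - $\mathcal{C}(a)$ is the set of all finite $X\subseteq S$ with $a\notin\downarrow X$ and $a\leq\bigvee X$ (the nontrivial join-covers of $a$; they are necessarily nonempty); - $\mathcal{M}(a)$ is the set of all $E\in\mathcal{C}(a)$ such that for every $X\in\mathcal{C}(a)$, $X\ll E$ implies $E\subseteq X$. $S$ has the MCRP if for every $a\in S^-$, every element of $\mathcal{C}(a)$ is refined by some element of $\mathcal{M}(a)$, and $\mathcal{M}(a)$ is finite. *)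

theory Defs
  imports "HOL-Algebra.Complete_Lattice"
begin

section \<open>Algebraic lattices\<close>

definition directed_subset :: "('a, 'b) gorder_scheme \<Rightarrow> 'a set \<Rightarrow> bool" where
  "directed_subset L X \<longleftrightarrow>
     X \<subseteq> carrier L \<and> X \<noteq> {} \<and>
     (\<forall>x\<in>X. \<forall>y\<in>X. \<exists>z\<in>X. x \<sqsubseteq>\<^bsub>L\<^esub> z \<and> y \<sqsubseteq>\<^bsub>L\<^esub> z)"

text \<open>
  Used only for complete \<open>L\<close>; elsewhere \<open>\<Squnion>\<^bsub>L\<^esub> X\<close> may be an unspecified value.
\<close>

definition compact_element :: "('a, 'b) gorder_scheme \<Rightarrow> 'a \<Rightarrow> bool" where
  "compact_element L a \<longleftrightarrow>
     a \<in> carrier L \<and>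
     (\<forall>X. directed_subset L X \<and> a \<sqsubseteq>\<^bsub>L\<^esub> \<Squnion>\<^bsub>L\<^esub> X \<longrightarrow> (\<exists>x\<in>X. a \<sqsubseteq>\<^bsub>L\<^esub> x))"

definition algebraic_lattice :: "('a, 'b) gorder_scheme \<Rightarrow> bool" where
  "algebraic_lattice L \<longleftrightarrow>
     complete_lattice L \<and>
     (\<forall>a\<in>carrier L. \<exists>K. (\<forall>k\<in>K. compact_element L k) \<and> a = \<Squnion>\<^bsub>L\<^esub> K)"

definition dually_algebraic_lattice :: "('a, 'b) gorder_scheme \<Rightarrow> bool" where
  "dually_algebraic_lattice L \<longleftrightarrow> algebraic_lattice (inv_gorder L)"

definition bialgebraic_lattice :: "('a, 'b) gorder_scheme \<Rightarrow> bool" where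
  "bialgebraic_lattice L \<longleftrightarrow> algebraic_lattice L \<and> dually_algebraic_lattice L"


section \<open>The ideal lattice of a join-semilattice\<close>

definition down_set :: "('a, 'b) gorder_scheme \<Rightarrow> 'a set \<Rightarrow> 'a set" where
  "down_set S X = {y \<in> carrier S. \<exists>x\<in>X. y \<sqsubseteq>\<^bsub>S\<^esub> x}"

text \<open>
  The finite joins include the empty one: \<open>is_lub S z {}\<close> says that \<open>z\<close> is the least element
  of \<open>S\<close>. Hence an ideal contains the zero element of \<open>S\<close> if there is one, and \<open>{}\<close> is an
  ideal precisely when \<open>S\<close> has no zero element.
\<close>

definition semilattice_ideal :: "('a, 'b) gorder_scheme \<Rightarrow> 'a set \<Rightarrow> bool" where
  "semilattice_ideal S I \<longleftrightarrow>
     I \<subseteq> carrier S \<and>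
     down_set S I \<subseteq> I \<and>
     (\<forall>X s. finite X \<and> X \<subseteq> I \<and> is_lub S s X \<longrightarrow> s \<in> I)"

definition Id_lattice :: "('a, 'b) gorder_scheme \<Rightarrow> 'a set gorder" where
  "Id_lattice S = \<lparr> carrier = {I. semilattice_ideal S I}, eq = (=), le = (\<subseteq>) \<rparr>"


section \<open>Minimal join-covers\<close>

definition nonzero_elements :: "('a, 'b) gorder_scheme \<Rightarrow> 'a set" where
  "nonzero_elements S = {a \<in> carrier S. \<not> least S a (carrier S)}"

definition refines :: "('a, 'b) gorder_scheme \<Rightarrow> 'a set \<Rightarrow> 'a set \<Rightarrow> bool" where
  "refines S X Y \<longleftrightarrow> X \<subseteq> down_set S Y"

text \<open>
  The join of \<open>X\<close> is required to exist, which matters only for \<open>X = {}\<close>; the empty set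
  never covers a nonzero element.
\<close>

definition join_covers :: "('a, 'b) gorder_scheme \<Rightarrow> 'a \<Rightarrow> 'a set set" where
  "join_covers S a =
     {X. finite X \<and> X \<subseteq> carrier S \<and> a \<notin> down_set S X \<and>
         (\<exists>s. is_lub S s X \<and> a \<sqsubseteq>\<^bsub>S\<^esub> s)}"

definition minimal_join_covers :: "('a, 'b) gorder_scheme \<Rightarrow> 'a \<Rightarrow> 'a set set" where
  "minimal_join_covers S a =
     {E \<in> join_covers S a. \<forall>X\<in>join_covers S a. refines S X E \<longrightarrow> E \<subseteq> X}"

definition MCRP :: "('a, 'b) gorder_scheme \<Rightarrow> bool" where
  "MCRP S \<longleftrightarrow>
     (\<forall>a\<in>nonzero_elements S.
        (\<forall>X\<in>join_covers S a. \<exists>E\<in>minimal_join_covers S a. refines S E X) \<and>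
        finite (minimal_join_covers S a))"

end

theory Submission
  imports Defs
begin

text \<open>
  The family of ideals is closed under intersections and directed unions, and every ideal is the
  join of the principal ideals it contains; this gives algebraicity without MCRP.

  For dual algebraicity, let \<open>I\<close> be an ideal with \<open>a \<notin> I\<close>, and let \<open>M \<supseteq> I\<close> be an ideal maximal
  with respect to \<open>a \<notin> M\<close> (Zorn). Then \<open>M\<close> is dually compact. Indeed, let \<open>D\<close> be a down-directed
  family of ideals none of which is contained in \<open>M\<close>. For \<open>J \<in> D\<close>, maximality puts \<open>a\<close> in the
  ideal generated by \<open>M\<close> and some \<open>b \<in> J\<close>, so either \<open>a \<in> J\<close> or a two-element join-cover of \<open>a\<close>
  inside \<open>M \<union> J\<close> is refined by some minimal \<open>E \<subseteq> M \<union> J\<close>. There are only finitely many such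
  \<open>E\<close>, so by directedness one of these containments holds for all \<open>J\<close>
  simultaneously; hence \<open>a \<in> \<Inter>D\<close> or \<open>E \<subseteq> M \<union> \<Inter>D\<close>. If \<open>\<Inter>D \<subseteq> M\<close>, either case yields
  \<open>a \<in> M\<close>, a contradiction. So \<open>I\<close> is the intersection of the dually compact ideals above it.
\<close>

section \<open>Ideals\<close>

lemma semilattice_ideal_subset: "semilattice_ideal S I \<Longrightarrow> I \<subseteq> carrier S"
  by (simp add: semilattice_ideal_def)

lemma semilattice_ideal_downD:
  "\<lbrakk>semilattice_ideal S I; x \<in> I; y \<in> carrier S; y \<sqsubseteq>\<^bsub>S\<^esub> x\<rbrakk> \<Longrightarrow> y \<in> I"
  by (auto simp: semilattice_ideal_def down_set_def)

lemma semilattice_ideal_lubD: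
  "\<lbrakk>semilattice_ideal S I; finite X; X \<subseteq> I; is_lub S s X\<rbrakk> \<Longrightarrow> s \<in> I"
  unfolding semilattice_ideal_def by blast

text \<open>The factor \<open>carrier S\<close> matters only for \<open>K = {}\<close>, where
  \<open>\<Inter>K\<close> is the whole type; the largest ideal results.\<close>

lemma semilattice_ideal_Inter:
  assumes "K \<subseteq> Collect (semilattice_ideal S)"
  shows "semilattice_ideal S (carrier S \<inter> \<Inter>K)"
  unfolding semilattice_ideal_def
proof (intro conjI allI impI)
  show "down_set S (carrier S \<inter> \<Inter>K) \<subseteq> carrier S \<inter> \<Inter>K"
    using assms unfolding down_set_def by (auto dest: semilattice_ideal_downD)
  show "s \<in> carrier S \<inter> \<Inter>K" if "finite X \<and> X \<subseteq> carrier S \<inter> \<Inter>K \<and> is_lub S s X" for X s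
  proof -
    have "s \<in> k" if "k \<in> K" for k
      by (rule semilattice_ideal_lubD[of S k X]) (use assms \<open>k \<in> K\<close> \<open>finite X \<and> _\<close> in auto)
    then show ?thesis using that by auto
  qed
qed simp

text \<open>Nonemptiness matters: \<open>\<Union>{} = {}\<close> is not an ideal when there is a zero.\<close>

lemma semilattice_ideal_directed_Union:
  assumes "D \<subseteq> Collect (semilattice_ideal S)" "D \<noteq> {}"
    and dir: "\<And>I J. \<lbrakk>I \<in> D; J \<in> D\<rbrakk> \<Longrightarrow> \<exists>K\<in>D. I \<subseteq> K \<and> J \<subseteq> K"
  shows "semilattice_ideal S (\<Union>D)"
  unfolding semilattice_ideal_def
proof (intro conjI allI impI)
  show "\<Union>D \<subseteq> carrier S"
    using assms(1) by (auto dest: semilattice_ideal_subset)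
  show "down_set S (\<Union>D) \<subseteq> \<Union>D"
    using assms(1) unfolding down_set_def by (auto dest: semilattice_ideal_downD)
  \<comment> \<open>Directedness puts a finite subset of the union into a single member, which then
    contains its join.\<close>
  have member: "\<exists>I\<in>D. X \<subseteq> I" if "finite X" "X \<subseteq> \<Union>D" for X
    using that
  proof (induction X rule: finite_induct)
    case empty
    then show ?case using assms(2) by blast
  next
    case (insert x X)
    then obtain I J where IJ: "I \<in> D" "X \<subseteq> I" "J \<in> D" "x \<in> J" by auto
    then obtain K where "K \<in> D" "I \<subseteq> K" "J \<subseteq> K" using dir by meson
    with IJ show ?case by (intro bexI[of _ K]) auto
  qed
  show "s \<in> \<Union>D" if X: "finite X \<and> X \<subseteq> \<Union>D \<and> is_lub S s X" for X s
  proof -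
    obtain I where "I \<in> D" "X \<subseteq> I" using member[of X] X by auto
    then have "s \<in> I"
      using semilattice_ideal_lubD[of S I X s] assms(1) X by auto
    with \<open>I \<in> D\<close> show ?thesis by auto
  qed
qed


section \<open>The complete lattice of ideals\<close>

lemma Id_lattice_simps [simp]:
  "carrier (Id_lattice S) = Collect (semilattice_ideal S)"
  "le (Id_lattice S) = (\<subseteq>)"
  "eq (Id_lattice S) = (=)"
  by (simp_all add: Id_lattice_def)

lemma partial_order_Id_lattice: "partial_order (Id_lattice S)"
  by unfold_locales auto

lemma Id_lattice_is_glb:
  assumes "K \<subseteq> Collect (semilattice_ideal S)"
  shows "greatest (Id_lattice S) (carrier S \<inter> \<Inter>K) (Lower (Id_lattice S) K)"
  using assms semilattice_ideal_Inter[OF assms]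
  by (auto simp: greatest_def Lower_def dest: semilattice_ideal_subset)

lemma Id_lattice_is_lub:
  assumes "K \<subseteq> Collect (semilattice_ideal S)"
  shows "is_lub (Id_lattice S) (carrier S \<inter> \<Inter>{I. semilattice_ideal S I \<and> \<Union>K \<subseteq> I}) K"
proof -
  let ?U = "{I. semilattice_ideal S I \<and> \<Union>K \<subseteq> I}"
  have "semilattice_ideal S (carrier S \<inter> \<Inter>?U)"
    by (rule semilattice_ideal_Inter) auto
  then show ?thesis
    using assms by (auto simp: least_def Upper_def dest: semilattice_ideal_subset)
qed

lemma complete_lattice_Id_lattice: "complete_lattice (Id_lattice S)"
proof -
  interpret partial_order "Id_lattice S" by (rule partial_order_Id_lattice)
  show ?thesis
    by unfold_locales (use Id_lattice_is_lub[of _ S] Id_lattice_is_glb[of _ S] in auto)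
qed

lemma complete_lattice_inv_Id_lattice: "complete_lattice (inv_gorder (Id_lattice S))"
proof -
  interpret partial_order "inv_gorder (Id_lattice S)"
    by unfold_locales auto
  show ?thesis
  proof
    fix K assume "K \<subseteq> carrier (inv_gorder (Id_lattice S))"
    then have K: "K \<subseteq> Collect (semilattice_ideal S)" by simp
    show "\<exists>s. is_lub (inv_gorder (Id_lattice S)) s K"
      unfolding least_dual Upper_dual using Id_lattice_is_glb[OF K] by blast
    show "\<exists>i. is_glb (inv_gorder (Id_lattice S)) i K"
      unfolding greatest_dual Lower_dual using Id_lattice_is_lub[OF K] by blast
  qed
qed

lemma Id_lattice_inf:
  assumes "K \<subseteq> Collect (semilattice_ideal S)"
  shows "\<Sqinter>\<^bsub>Id_lattice S\<^esub> K = carrier S \<inter> \<Inter>K"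
  \<comment> \<open>\<open>Lattice.inf\<close> is a Hilbert choice; antisymmetry of inclusion leaves
    only one candidate.\<close>
  unfolding Lattice.inf_def
  by (rule some_equality)
    (use Id_lattice_is_glb[OF assms] in \<open>force simp only: greatest_def Id_lattice_simps\<close>)+

lemma Id_lattice_supI:
  assumes "K \<subseteq> Collect (semilattice_ideal S)" "semilattice_ideal S I" "\<Union>K \<subseteq> I"
    and "\<And>J. \<lbrakk>semilattice_ideal S J; \<Union>K \<subseteq> J\<rbrakk> \<Longrightarrow> I \<subseteq> J"
  shows "\<Squnion>\<^bsub>Id_lattice S\<^esub> K = I"
proof -
  have lub: "is_lub (Id_lattice S) I K"
    unfolding least_def
  proof (intro conjI ballI)
    show "I \<in> Upper (Id_lattice S) K" using assms(2,3) by (auto simp: Upper_def)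
    show "I \<sqsubseteq>\<^bsub>Id_lattice S\<^esub> J" if "J \<in> Upper (Id_lattice S) K" for J
    proof -
      have "semilattice_ideal S J" "\<Union>K \<subseteq> J" using that assms(1) by (auto simp: Upper_def)
      then show ?thesis using assms(4) by simp
    qed
  qed (auto simp: Upper_def)
  then show ?thesis
    unfolding Lattice.sup_def
    by (rule some_equality) (use lub in \<open>force simp only: least_def Id_lattice_simps\<close>)+
qed

text \<open>A directed union is already an ideal, so forming the join adds no elements.\<close>

lemma Id_lattice_sup_directed:
  assumes "directed_subset (Id_lattice S) D"
  shows "\<Squnion>\<^bsub>Id_lattice S\<^esub> D = \<Union>D"
  using assms unfolding directed_subset_def
  by (intro Id_lattice_supI semilattice_ideal_directed_Union) auto


section \<open>Ideals of a join-semilattice\<close>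

context upper_semilattice
begin

text \<open>Iterated binary joins give every nonempty finite subset an upper bound in
  \<open>I\<close>; its least upper bound lies below that one. The zero accounts for the empty
  join.\<close>

lemma semilattice_idealI:
  assumes "I \<subseteq> carrier L"
    and down: "\<And>x y. \<lbrakk>x \<in> I; y \<in> carrier L; y \<sqsubseteq> x\<rbrakk> \<Longrightarrow> y \<in> I"
    and join: "\<And>x y. \<lbrakk>x \<in> I; y \<in> I\<rbrakk> \<Longrightarrow> x \<squnion> y \<in> I"
    and zero: "\<And>z. least L z (carrier L) \<Longrightarrow> z \<in> I"
  shows "semilattice_ideal L I"
  unfolding semilattice_ideal_def
proof (intro conjI allI impI)
  show "down_set L I \<subseteq> I" using down by (auto simp: down_set_def)
  have bound: "\<exists>u\<in>I. \<forall>x\<in>X. x \<sqsubseteq> u" if "finite X" "X \<noteq> {}" "X \<subseteq> I" for X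
    using that
  proof (induction X rule: finite_ne_induct)
    case (singleton x)
    then show ?case using assms(1) by blast
  next
    case (insert x X)
    then obtain u where u: "u \<in> I" "\<forall>y\<in>X. y \<sqsubseteq> u" by auto
    have "y \<sqsubseteq> u \<squnion> x" if "y \<in> insert x X" for y
      using that u insert.prems assms(1) join_left[of u x] join_right[of u x]
        le_trans[of y u "u \<squnion> x"] join_closed[of u x] by blast
    moreover have "u \<squnion> x \<in> I" using join u insert.prems by blast
    ultimately show ?case by blast
  qed
  show "s \<in> I" if X: "finite X \<and> X \<subseteq> I \<and> is_lub L s X" for X s
  proof (cases "X = {}")
    case True
    then show ?thesis using X zero by simp
  next
    case False
    then obtain u where u: "u \<in> I" "\<forall>x\<in>X. x \<sqsubseteq> u" using bound X by blast
    then have "u \<in> Upper L X" using assms(1) by (auto simp: Upper_def)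
    then have "s \<sqsubseteq> u" using X by (blast intro: least_le)
    then show ?thesis using down u X by blast
  qed
qed (rule assms(1))

lemma is_lub_join: "\<lbrakk>x \<in> carrier L; y \<in> carrier L\<rbrakk> \<Longrightarrow> is_lub L (x \<squnion> y) {x, y}"
  unfolding join_def by (rule sup_of_two_least)

lemma semilattice_ideal_joinD:
  assumes "semilattice_ideal L I" "x \<in> I" "y \<in> I"
  shows "x \<squnion> y \<in> I"
proof (rule semilattice_ideal_lubD[OF assms(1)])
  show "is_lub L (x \<squnion> y) {x, y}"
    using assms semilattice_ideal_subset[OF assms(1)] by (intro is_lub_join) auto
qed (use assms in auto)

lemma semilattice_ideal_zeroD:
  "\<lbrakk>semilattice_ideal L I; least L z (carrier L)\<rbrakk> \<Longrightarrow> z \<in> I"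
  by (rule semilattice_ideal_lubD[where X = "{}"]) auto

lemma semilattice_ideal_principal:
  assumes "a \<in> carrier L"
  shows "semilattice_ideal L (down_set L {a})"
proof (rule semilattice_idealI)
  show "y \<in> down_set L {a}" if "x \<in> down_set L {a}" "y \<in> carrier L" "y \<sqsubseteq> x" for x y
    using that assms le_trans[of y x a] by (auto simp: down_set_def)
qed (use assms join_le in \<open>auto simp: down_set_def least_def\<close>)

lemma principal_subset_ideal_iff:
  assumes "a \<in> carrier L" "semilattice_ideal L I"
  shows "down_set L {a} \<subseteq> I \<longleftrightarrow> a \<in> I"
  using assms by (auto simp: down_set_def dest: semilattice_ideal_downD)

text \<open>A directed join is a union, so the generator \<open>a\<close> already lies in one member
  of the family.\<close>

lemma compact_principal_ideal:
  assumes "a \<in> carrier L"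
  shows "compact_element (Id_lattice L) (down_set L {a})"
  unfolding compact_element_def
proof (intro conjI allI impI)
  fix D
  assume D: "directed_subset (Id_lattice L) D \<and>
    down_set L {a} \<sqsubseteq>\<^bsub>Id_lattice L\<^esub> \<Squnion>\<^bsub>Id_lattice L\<^esub> D"
  then have "down_set L {a} \<subseteq> \<Union>D" using Id_lattice_sup_directed[of L D] by simp
  then obtain I where "I \<in> D" "a \<in> I" using assms by (auto simp: down_set_def)
  then show "\<exists>I\<in>D. down_set L {a} \<sqsubseteq>\<^bsub>Id_lattice L\<^esub> I"
    using D assms principal_subset_ideal_iff[of a I] by (auto simp: directed_subset_def)
qed (simp add: assms semilattice_ideal_principal)

lemma algebraic_Id_lattice: "algebraic_lattice (Id_lattice L)"
  unfolding algebraic_lattice_def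
proof (intro conjI ballI)
  fix I assume "I \<in> carrier (Id_lattice L)"
  then have I: "semilattice_ideal L I" by simp
  note sub = semilattice_ideal_subset[OF I]
  \<comment> \<open>If \<open>I\<close> is the empty ideal, \<open>?K\<close> is empty too, and its
    join is the least ideal \<open>{}\<close>.\<close>
  let ?K = "(\<lambda>a. down_set L {a}) ` I"
  have "\<Squnion>\<^bsub>Id_lattice L\<^esub> ?K = I"
  proof (rule Id_lattice_supI)
    show "\<Union>?K \<subseteq> I" using principal_subset_ideal_iff I sub by blast
    show "I \<subseteq> J" if "semilattice_ideal L J" "\<Union>?K \<subseteq> J" for J
    proof
      fix a assume "a \<in> I"
      then have "a \<in> carrier L" "down_set L {a} \<subseteq> J" using that sub by auto
      then show "a \<in> J" using principal_subset_ideal_iff that by blast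
    qed
  qed (use I sub semilattice_ideal_principal in auto)
  moreover have "\<forall>k\<in>?K. compact_element (Id_lattice L) k"
    using compact_principal_ideal sub by auto
  ultimately show "\<exists>K. (\<forall>k\<in>K. compact_element (Id_lattice L) k) \<and> I = \<Squnion>\<^bsub>Id_lattice L\<^esub> K"
    by metis
qed (rule complete_lattice_Id_lattice)

text \<open>
  The ideal generated by \<open>M\<close> and \<open>b\<close>. The disjunct \<open>y \<sqsubseteq> b\<close> is redundant unless \<open>M = {}\<close>.
\<close>

lemma semilattice_ideal_adjoin:
  assumes M: "semilattice_ideal L M" and b: "b \<in> carrier L"
  shows "semilattice_ideal L {y \<in> carrier L. y \<sqsubseteq> b \<or> (\<exists>m\<in>M. y \<sqsubseteq> m \<squnion> b)}"
    (is "semilattice_ideal L ?I")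
proof (rule semilattice_idealI)
  note Mc = subsetD[OF semilattice_ideal_subset[OF M]]
  show "y \<in> ?I" if "x \<in> ?I" "y \<in> carrier L" "y \<sqsubseteq> x" for x y
  proof -
    have "\<forall>c\<in>carrier L. x \<sqsubseteq> c \<longrightarrow> y \<sqsubseteq> c"
      using that le_trans[of y x] by simp
    moreover have "\<forall>m\<in>M. m \<squnion> b \<in> carrier L"
      using b Mc by simp
    ultimately show ?thesis using that b by auto
  qed
  show "z \<in> ?I" if "least L z (carrier L)" for z
    using that b by (auto simp: least_def)
  have mono: "y \<sqsubseteq> n \<squnion> b"
    if "y \<in> carrier L" "y \<sqsubseteq> m \<squnion> b" "m \<in> M" "n \<in> M" "m \<sqsubseteq> n" for y m n
  proof -
    have "m \<squnion> b \<sqsubseteq> n \<squnion> b"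
      using that b Mc join_left[of n b] join_right[of n b] le_trans[of m n "n \<squnion> b"]
      by (intro join_le) auto
    then show ?thesis using that b Mc le_trans[of y "m \<squnion> b" "n \<squnion> b"] by auto
  qed
  have below: "y \<sqsubseteq> m \<squnion> b" if "y \<in> carrier L" "y \<sqsubseteq> b" "m \<in> M" for y m
    using that b Mc join_right[of m b] le_trans[of y b "m \<squnion> b"] by auto
  show "x \<squnion> y \<in> ?I" if x: "x \<in> ?I" and y: "y \<in> ?I" for x y
  proof (cases "x \<sqsubseteq> b \<and> y \<sqsubseteq> b")
    case True
    then show ?thesis using x y b join_le[of x b y] by auto
  next
    case False
    \<comment> \<open>Now \<open>M\<close> is nonempty, so elements below \<open>b\<close> are also
      below \<open>k \<squnion> b\<close>, and both \<open>x\<close> and \<open>y\<close> have a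
      bound of the form \<open>m \<squnion> b\<close>.\<close>
    then obtain k where "k \<in> M" using x y by auto
    then have "\<exists>m\<in>M. x \<sqsubseteq> m \<squnion> b" "\<exists>m\<in>M. y \<sqsubseteq> m \<squnion> b"
      using x y below[of x k] below[of y k] by auto
    then obtain m n where mn: "m \<in> M" "x \<sqsubseteq> m \<squnion> b" "n \<in> M" "y \<sqsubseteq> n \<squnion> b" by blast
    have k: "m \<squnion> n \<in> M" using M mn by (auto intro: semilattice_ideal_joinD)
    have "x \<sqsubseteq> (m \<squnion> n) \<squnion> b" "y \<sqsubseteq> (m \<squnion> n) \<squnion> b"
      using mono[of x m "m \<squnion> n"] mono[of y n "m \<squnion> n"] x y k mn Mc join_left join_right
      by auto
    then have "x \<squnion> y \<sqsubseteq> (m \<squnion> n) \<squnion> b"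
      using x y k Mc b by (intro join_le) auto
    then show ?thesis using k x y by auto
  qed
qed auto

text \<open>Zorn's lemma applies because the union of a nonempty chain is a directed union, hence an
  ideal, and still avoids \<open>a\<close>.\<close>

lemma maximal_ideal_avoiding:
  assumes "semilattice_ideal L I" "a \<notin> I"
  obtains M where "semilattice_ideal L M" "I \<subseteq> M" "a \<notin> M"
    "\<And>J. \<lbrakk>semilattice_ideal L J; M \<subseteq> J; a \<notin> J\<rbrakk> \<Longrightarrow> J = M"
proof -
  let ?A = "{J. semilattice_ideal L J \<and> I \<subseteq> J \<and> a \<notin> J}"
  have "\<exists>M\<in>?A. \<forall>J\<in>?A. M \<subseteq> J \<longrightarrow> J = M"
  proof (rule subset_Zorn_nonempty)
    show "\<Union>C \<in> ?A" if C: "C \<noteq> {}" "subset.chain ?A C" for C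
    proof -
      have "semilattice_ideal L (\<Union>C)"
        by (rule semilattice_ideal_directed_Union)
          (use C in \<open>simp_all add: subset_chain_def, blast, meson order_refl\<close>)
      then show ?thesis using C by (auto simp: subset_chain_def)
    qed
  qed (use assms in auto)
  then obtain M where "M \<in> ?A" "\<forall>J\<in>?A. M \<subseteq> J \<longrightarrow> J = M" by blast
  then show thesis by (intro that[of M]) auto
qed


section \<open>Dual algebraicity\<close>

lemma minimal_join_cover_in_ideal:
  assumes "semilattice_ideal L M" "E \<in> minimal_join_covers L a" "E \<subseteq> M" "a \<in> carrier L"
  shows "a \<in> M"
proof -
  obtain s where s: "finite E" "is_lub L s E" "a \<sqsubseteq> s"
    using assms(2) by (auto simp: minimal_join_covers_def join_covers_def)
  have "s \<in> M" by (rule semilattice_ideal_lubD[OF assms(1) s(1) assms(3) s(2)])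
  then show ?thesis by (rule semilattice_ideal_downD[OF assms(1) _ assms(4) s(3)])
qed

text \<open>Otherwise each \<open>E\<close> in \<open>F\<close> fails at some \<open>f E\<close> in
  \<open>D\<close>; a common lower bound in \<open>D\<close> of these finitely many sets would
  defeat every \<open>E\<close> at once.\<close>

lemma down_directed_finite_choice:
  assumes "finite F" "D \<noteq> {}"
    and dir: "\<And>I J. \<lbrakk>I \<in> D; J \<in> D\<rbrakk> \<Longrightarrow> \<exists>K\<in>D. K \<subseteq> I \<and> K \<subseteq> J"
    and ex: "\<And>J. J \<in> D \<Longrightarrow> \<exists>E\<in>F. E \<subseteq> M \<union> J"
  obtains E where "E \<in> F" "E \<subseteq> M \<union> \<Inter>D"
proof -
  have "\<exists>E\<in>F. \<forall>J\<in>D. E \<subseteq> M \<union> J"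
  proof (rule ccontr)
    assume "\<not> ?thesis"
    then have "\<forall>E\<in>F. \<exists>J\<in>D. \<not> E \<subseteq> M \<union> J" by blast
    then obtain f where f: "\<And>E. E \<in> F \<Longrightarrow> f E \<in> D \<and> \<not> E \<subseteq> M \<union> f E" by metis
    have "\<exists>K\<in>D. \<forall>E\<in>G. K \<subseteq> f E" if "finite G" "G \<subseteq> F" for G
      using that
    proof (induction G rule: finite_induct)
      case empty
      then show ?case using assms(2) by blast
    next
      case (insert E G)
      then obtain K where K: "K \<in> D" "\<forall>E\<in>G. K \<subseteq> f E" by auto
      have "f E \<in> D" using f insert.prems by simp
      then obtain K' where "K' \<in> D" "K' \<subseteq> K" "K' \<subseteq> f E" using dir[OF K(1)] by meson
      with K show ?case by (intro bexI[of _ K']) auto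
    qed
    then obtain K where "K \<in> D" "\<forall>E\<in>F. K \<subseteq> f E" using assms(1) by blast
    with ex[of K] f show False by blast
  qed
  \<comment> \<open>Union with \<open>M\<close> distributes over the intersection of
    \<open>D\<close>.\<close>
  then show thesis using that by blast
qed

text \<open>The extra set \<open>{a}\<close> encodes the case \<open>a \<in> J\<close>, so that a
  single finite family of candidates, independent of \<open>J\<close>, serves both cases.\<close>

lemma MCRP_cover_in_union:
  assumes "MCRP L" "semilattice_ideal L M" "a \<in> carrier L" "a \<notin> M"
    and max: "\<And>J. \<lbrakk>semilattice_ideal L J; M \<subseteq> J; a \<notin> J\<rbrakk> \<Longrightarrow> J = M"
    and J: "semilattice_ideal L J" "\<not> J \<subseteq> M"
  shows "\<exists>E\<in>insert {a} (minimal_join_covers L a). E \<subseteq> M \<union> J"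
proof (cases "a \<in> J")
  case False
  note Mc = subsetD[OF semilattice_ideal_subset[OF assms(2)]]
  obtain b where b: "b \<in> J" "b \<notin> M" using J by blast
  then have bc: "b \<in> carrier L" using J semilattice_ideal_subset by blast
  let ?G = "{y \<in> carrier L. y \<sqsubseteq> b \<or> (\<exists>m\<in>M. y \<sqsubseteq> m \<squnion> b)}"
  have "b \<in> ?G" using bc by auto
  moreover have "M \<subseteq> ?G"
  proof
    fix m assume "m \<in> M"
    then show "m \<in> ?G" using Mc[of m] bc join_left[of m b] by auto
  qed
  \<comment> \<open>The ideal \<open>?G\<close> contains \<open>M\<close> properly, because of
    \<open>b\<close>; maximality forces \<open>a\<close> into it.\<close>
  ultimately have "a \<in> ?G"
    using max[OF semilattice_ideal_adjoin[OF assms(2) bc]] b by blast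
  moreover have ab: "\<not> a \<sqsubseteq> b" using semilattice_ideal_downD[OF J(1) b(1) assms(3)] False by auto
  ultimately obtain m where m: "m \<in> M" "a \<sqsubseteq> m \<squnion> b" by blast
  have am: "\<not> a \<sqsubseteq> m" using semilattice_ideal_downD[OF assms(2) m(1) assms(3)] assms(4) by auto
  \<comment> \<open>The cover is nontrivial: \<open>a\<close> below \<open>m\<close> would put
    \<open>a\<close> in \<open>M\<close>, and \<open>a\<close> below \<open>b\<close> would put it
    in \<open>J\<close>.\<close>
  have "{m, b} \<in> join_covers L a"
    using m ab am bc Mc is_lub_join[of m b] by (auto simp: join_covers_def down_set_def)
  \<comment> \<open>A zero element would belong to the ideal \<open>M\<close>.\<close>
  moreover have "a \<in> nonzero_elements L"
    using assms semilattice_ideal_zeroD by (auto simp: nonzero_elements_def)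
  ultimately obtain E where E: "E \<in> minimal_join_covers L a" "refines L E {m, b}"
    using assms(1) unfolding MCRP_def by blast
  have "E \<subseteq> M \<union> J"
    using E(2) m b semilattice_ideal_downD[OF assms(2)] semilattice_ideal_downD[OF J(1)]
    by (auto simp: refines_def down_set_def)
  with E show ?thesis by blast
qed auto

lemma dually_compact_maximal_ideal:
  assumes "MCRP L" "semilattice_ideal L M" "a \<in> carrier L" "a \<notin> M"
    and max: "\<And>J. \<lbrakk>semilattice_ideal L J; M \<subseteq> J; a \<notin> J\<rbrakk> \<Longrightarrow> J = M"
  shows "compact_element (inv_gorder (Id_lattice L)) M"
  unfolding compact_element_def
proof (intro conjI allI impI)
  fix D
  assume "directed_subset (inv_gorder (Id_lattice L)) D \<and>
    M \<sqsubseteq>\<^bsub>inv_gorder (Id_lattice L)\<^esub> \<Squnion>\<^bsub>inv_gorder (Id_lattice L)\<^esub> D"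
  then have D: "D \<subseteq> Collect (semilattice_ideal L)" "D \<noteq> {}"
    "\<And>I J. \<lbrakk>I \<in> D; J \<in> D\<rbrakk> \<Longrightarrow> \<exists>K\<in>D. K \<subseteq> I \<and> K \<subseteq> J"
    and inf: "\<Sqinter>\<^bsub>Id_lattice L\<^esub> D \<subseteq> M"
    by (simp_all only: directed_subset_def sup_dual) auto
  \<comment> \<open>Since \<open>D\<close> is nonempty, intersecting with the carrier changes
    nothing.\<close>
  have sub: "\<Inter>D \<subseteq> M" using D(1,2) inf unfolding Id_lattice_inf[OF D(1)] by (blast dest: semilattice_ideal_subset)
  have nz: "a \<in> nonzero_elements L"
    using assms semilattice_ideal_zeroD by (auto simp: nonzero_elements_def)
  show "\<exists>J\<in>D. M \<sqsubseteq>\<^bsub>inv_gorder (Id_lattice L)\<^esub> J"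
  proof (rule ccontr)
    assume "\<not> ?thesis"
    then have nsub: "\<not> J \<subseteq> M" if "J \<in> D" for J using that by auto
    have "finite (insert {a} (minimal_join_covers L a))"
      using assms(1) nz by (auto simp: MCRP_def)
    moreover have "\<exists>E\<in>insert {a} (minimal_join_covers L a). E \<subseteq> M \<union> J" if "J \<in> D" for J
      using MCRP_cover_in_union[OF assms, of J] D(1) nsub that by blast
    ultimately obtain E where
      "E \<in> insert {a} (minimal_join_covers L a)" "E \<subseteq> M \<union> \<Inter>D"
      using down_directed_finite_choice[of _ D M] D(2,3) by metis
    \<comment> \<open>With \<open>\<Inter>D \<subseteq> M\<close> the chosen \<open>E\<close> lies
      in \<open>M\<close>. Whether \<open>E\<close> is \<open>{a}\<close> or a cover of
      \<open>a\<close>, this gives \<open>a \<in> M\<close>.\<close>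
    with sub minimal_join_cover_in_ideal[of M E a] assms(2-4) show False by blast
  qed
qed (simp add: assms)

lemma dually_algebraic_Id_lattice:
  assumes "MCRP L"
  shows "dually_algebraic_lattice (Id_lattice L)"
  unfolding dually_algebraic_lattice_def algebraic_lattice_def
proof (intro conjI ballI)
  fix I assume "I \<in> carrier (inv_gorder (Id_lattice L))"
  then have I: "semilattice_ideal L I" by simp
  let ?K = "{M. compact_element (inv_gorder (Id_lattice L)) M \<and> I \<subseteq> M}"
  have K: "?K \<subseteq> Collect (semilattice_ideal L)" by (auto simp: compact_element_def)
  \<comment> \<open>Each element outside \<open>I\<close> is excluded by a maximal ideal above
    \<open>I\<close> avoiding it, and that ideal belongs to \<open>?K\<close>.\<close>
  have "a \<in> I" if a: "a \<in> carrier L" "a \<in> \<Inter>?K" for a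
  proof (rule ccontr)
    assume "a \<notin> I"
    then obtain M where "semilattice_ideal L M" "I \<subseteq> M" "a \<notin> M"
      "\<And>J. \<lbrakk>semilattice_ideal L J; M \<subseteq> J; a \<notin> J\<rbrakk> \<Longrightarrow> J = M"
      using maximal_ideal_avoiding[OF I] by blast
    with dually_compact_maximal_ideal[OF assms, of M a] a show False by blast
  qed
  then have "carrier L \<inter> \<Inter>?K = I" using semilattice_ideal_subset[OF I] by blast
  then have "I = \<Squnion>\<^bsub>inv_gorder (Id_lattice L)\<^esub> ?K" by (simp only: sup_dual Id_lattice_inf[OF K])
  then show "\<exists>K. (\<forall>k\<in>K. compact_element (inv_gorder (Id_lattice L)) k) \<and>
      I = \<Squnion>\<^bsub>inv_gorder (Id_lattice L)\<^esub> K"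
    by (intro exI[of _ ?K] conjI) auto
qed (rule complete_lattice_inv_Id_lattice)

end

theorem corollary6p3:
  fixes S :: "('a, 'b) gorder_scheme"
  assumes "upper_semilattice S"
    and "MCRP S"
  shows "bialgebraic_lattice (Id_lattice S)"
  unfolding bialgebraic_lattice_def
  using upper_semilattice.algebraic_Id_lattice[OF assms(1)]
    upper_semilattice.dually_algebraic_Id_lattice[OF assms] by blast

end
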